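(* Let $m, n, k$ be positive integers with $n$ odd and $k$ even. Then there exists a positive integer $D$ such that the continued fraction expansion of $\sqrt{D}$ has the form $\sqrt{D} = [a_0; \overline{a_1, \ldots, a_k}]$ with period length $k$, and $D \equiv m \pmod n$.
   Context: For a positive non-square integer $D$, the continued fraction expansion of $\sqrt{D}$ has the form $[a_0; \overline{a_1, \ldots, a_k}]$ with positive integers $a_i$, $a_k = 2a_0$, $(a_1,\dots,a_{k-1})$ a palindrome; $k$ is the period length. *)

theory Defs
  imports Complex_Main "HOL-Number_Theory.Cong"
begin

text \<open>
  Complete quotients and partial quotients of the regular continued fraction of a real number.
  For rational \<open>x\<close> the expansion is finite, and the convention \<open>1 / 0 = 0\<close> pads it with zeros;
  the notions below are meant for irrational \<open>x\<close>, where no division by zero occurs.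
\<close>

primrec cf_complete :: "real \<Rightarrow> nat \<Rightarrow> real" where
  "cf_complete x 0 = x"
| "cf_complete x (Suc i) = 1 / (cf_complete x i - of_int \<lfloor>cf_complete x i\<rfloor>)"

definition cf_quot :: "real \<Rightarrow> nat \<Rightarrow> int" where
  "cf_quot x i = \<lfloor>cf_complete x i\<rfloor>"

text \<open>The expansion of \<open>x\<close> is \<open>[a0; as, as, as, ...]\<close>; the block \<open>as\<close> may itself be a repetition
  of a shorter one.\<close>

definition cf_periodic_form :: "real \<Rightarrow> int \<Rightarrow> int list \<Rightarrow> bool" where
  "cf_periodic_form x a0 as \<longleftrightarrow>
     as \<noteq> [] \<and> cf_quot x 0 = a0 \<and> (\<forall>i. cf_quot x (Suc i) = as ! (i mod length as))"

text \<open>The period length is the least period of the partial quotients of index at least 1.\<close>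

definition cf_period :: "real \<Rightarrow> nat \<Rightarrow> bool" where
  "cf_period x k \<longleftrightarrow> k > 0 \<and> (\<forall>i\<ge>1. cf_quot x (i + k) = cf_quot x i)"

definition cf_period_length :: "real \<Rightarrow> nat \<Rightarrow> bool" where
  "cf_period_length x k \<longleftrightarrow> cf_period x k \<and> (\<forall>j. cf_period x j \<longrightarrow> k \<le> j)"

end

theory Submission
  imports Defs
begin

text \<open>
  Take all inner partial quotients equal to \<open>N = 2n\<close>. With \<open>u\<^sub>0 = 0\<close>, \<open>u\<^sub>1 = 1\<close>,
  \<open>u\<^sub>j\<^sub>+\<^sub>2 = N u\<^sub>j\<^sub>+\<^sub>1 + u\<^sub>j\<close>, the number \<open>x\<close> with expansion
  \<open>[a0; N, ..., N, 2 a0]\<close> (\<open>k - 1\<close> copies of \<open>N\<close>, the block repeated) satisfies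
  \<open>x\<^sup>2 = a0\<^sup>2 + t\<close>, where \<open>u\<^sub>k t = 2 u\<^sub>k\<^sub>-\<^sub>1 a0 + u\<^sub>k\<^sub>-\<^sub>2\<close>.
  Write \<open>A\<close>, \<open>B\<close>, \<open>C\<close> for \<open>u\<^sub>k\<close>, \<open>u\<^sub>k\<^sub>-\<^sub>1\<close>, \<open>u\<^sub>k\<^sub>-\<^sub>2\<close>. For even \<open>k\<close> one has
  \<open>B\<^sup>2 = A C + 1\<close>, so \<open>a0 = A s - B C / 2\<close>, \<open>t = 2 B s - C\<^sup>2\<close> is an integral solution for every \<open>s\<close>.
  Modulo \<open>2n\<close> one has \<open>A = C = 0\<close> and \<open>B = 1\<close>, hence \<open>a0\<^sup>2 + t\<close> is congruent to \<open>2 s\<close> modulo \<open>n\<close>,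
  and as \<open>n\<close> is odd every residue is attained. For large \<open>s\<close> the quotient \<open>2 a0\<close> differs from \<open>N\<close>,
  so the period is exactly \<open>k\<close>.
\<close>

text \<open>Start \<open>0, 1\<close> over the integers gives the \<open>u\<close>; start
  \<open>1, z\<close> over the reals gives the numerators and denominators of the complete
  quotients.\<close>

fun fib_seq :: "'a::comm_ring_1 \<Rightarrow> 'a \<Rightarrow> 'a \<Rightarrow> nat \<Rightarrow> 'a" where
  "fib_seq p a b 0 = a"
| "fib_seq p a b (Suc 0) = b"
| "fib_seq p a b (Suc (Suc j)) = p * fib_seq p a b (Suc j) + fib_seq p a b j"

lemma of_int_fib_seq:
  "of_int (fib_seq p a b j) = fib_seq (of_int p) (of_int a) (of_int b) j"
  by (induction p a b j rule: fib_seq.induct) auto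

lemma fib_seq_Suc:
  "fib_seq p a b (Suc j) = fib_seq p 0 1 (Suc j) * b + fib_seq p 0 1 j * a"
proof (induction j rule: induct_nat_012)
  case (ge2 j)
  have "fib_seq p a b (Suc (Suc (Suc j))) = p * fib_seq p a b (Suc (Suc j)) + fib_seq p a b (Suc j)"
    by simp
  also have "\<dots> = (p * fib_seq p 0 1 (Suc (Suc j)) + fib_seq p 0 1 (Suc j)) * b
      + (p * fib_seq p 0 1 (Suc j) + fib_seq p 0 1 j) * a"
    unfolding ge2 by (simp only: algebra_simps)
  finally show ?case by simp
qed (simp_all add: algebra_simps)

lemma fib_seq_cassini:
  "(fib_seq p 0 1 (Suc j))\<^sup>2 = fib_seq p 0 1 (Suc (Suc j)) * fib_seq p 0 1 j + (-1) ^ j"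
proof (induction j)
  case (Suc j)
  then show ?case by (simp add: algebra_simps power2_eq_square)
qed simp

text \<open>Modulo \<open>p\<close> the recurrence reads \<open>f (j + 2) = f j\<close>, so the
  values alternate 0, 1.\<close>

lemma fib_seq_parity:
  fixes p :: int
  assumes "even j"
  shows "p dvd fib_seq p 0 1 j" and "[fib_seq p 0 1 (Suc j) = 1] (mod p)"
proof -
  obtain i where j: "j = 2 * i" using assms by blast
  have "p dvd fib_seq p 0 1 (2 * i) \<and> [fib_seq p 0 1 (Suc (2 * i)) = 1] (mod p)"
    by (induction i) (auto simp: cong_iff_dvd_diff algebra_simps)
  then show "p dvd fib_seq p 0 1 j" "[fib_seq p 0 1 (Suc j) = 1] (mod p)"
    unfolding j by blast+
qed

lemma fib_seq_pos_less:
  fixes p a b :: "'a::linordered_idom"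
  assumes "p \<ge> 1" "0 < a" "a < b"
  shows "0 < fib_seq p a b j \<and> fib_seq p a b j < fib_seq p a b (Suc j)"
proof (induction j)
  case (Suc j)
  then have "1 * fib_seq p a b (Suc j) \<le> p * fib_seq p a b (Suc j)"
    using assms by (intro mult_right_mono) auto
  moreover have "fib_seq p a b (Suc (Suc j)) = p * fib_seq p a b (Suc j) + fib_seq p a b j"
    by simp
  ultimately show ?case using Suc by linarith
qed (use assms in auto)

lemma fib_seq_nonneg:
  fixes p :: "'a::linordered_idom"
  assumes "p \<ge> 1"
  shows "0 \<le> fib_seq p 0 1 j" and "1 \<le> fib_seq p 0 1 (Suc j)"
proof -
  have "0 \<le> fib_seq p 0 1 j \<and> 1 \<le> fib_seq p 0 1 (Suc j)"
  proof (induction j)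
    case (Suc j)
    then have "1 * 1 \<le> p * fib_seq p 0 1 (Suc j)"
      using assms by (intro mult_mono) auto
    with Suc show ?case by simp
  qed simp
  then show "0 \<le> fib_seq p 0 1 j" "1 \<le> fib_seq p 0 1 (Suc j)" by auto
qed

text \<open>One continued fraction step: dividing the recurrence by \<open>v (Suc j)\<close> leaves
  \<open>v j / v (Suc j)\<close>, a number in (0, 1) because \<open>v\<close> is positive and
  increasing.\<close>

lemma floor_fib_seq_ratio:
  fixes N :: int and z :: real
  assumes "N \<ge> 1" "z > 1"
  defines "v \<equiv> fib_seq (real_of_int N) 1 z"
  shows "v (Suc (Suc j)) / v (Suc j) = N + v j / v (Suc j)"
    and "\<lfloor>v (Suc (Suc j)) / v (Suc j)\<rfloor> = N"
proof -
  have v: "0 < v j" "v j < v (Suc j)"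
    using fib_seq_pos_less[of "real_of_int N" 1 z j] assms by auto
  then show eq: "v (Suc (Suc j)) / v (Suc j) = N + v j / v (Suc j)"
    by (simp add: v_def field_simps)
  show "\<lfloor>v (Suc (Suc j)) / v (Suc j)\<rfloor> = N"
    unfolding eq using v by (intro floor_unique) auto
qed

text \<open>With \<open>v\<close> started at \<open>1, a0 + sqrt D\<close>, the complete quotients
  of index at least 1 run through \<open>v j / v (j - 1)\<close> for j = k, ..., 1; the equation for
  \<open>t\<close> makes this cycle close.\<close>

lemma sqrt_cf_constant_inner:
  fixes N a0 t D :: int and k :: nat
  assumes k: "k \<ge> 2" and N: "N \<ge> 1" and a0: "a0 \<ge> 1"
    and D: "D = a0\<^sup>2 + t"
    and t: "fib_seq N 0 1 k * t = 2 * fib_seq N 0 1 (k - 1) * a0 + fib_seq N 0 1 (k - 2)"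
  shows "a0 < sqrt D" and "cf_quot (sqrt D) 0 = a0"
    and "cf_quot (sqrt D) (Suc i) = (if i mod k = k - 1 then 2 * a0 else N)"
proof -
  obtain l where l: "k = Suc (Suc l)" using k by (metis add_2_eq_Suc le_Suc_ex)
  define u where "u = fib_seq N 0 1"
  have upos: "1 \<le> u k" "1 \<le> u (Suc l)" "0 \<le> u l"
    using fib_seq_nonneg[OF N] by (auto simp: u_def l simp del: fib_seq.simps)
  have t': "u k * t = 2 * u (Suc l) * a0 + u l" using t by (simp add: u_def l)
  have "0 < 2 * u (Suc l) * a0" using upos a0 by simp
  then have "0 < u k * t" unfolding t' using upos by linarith
  then have tpos: "t > 0" using upos by (simp add: zero_less_mult_iff)
  define x where "x = sqrt D"
  have x2: "x\<^sup>2 = D" unfolding x_def using tpos D by simp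
  have "(real_of_int a0)\<^sup>2 < D" using tpos D by simp
  then have xa: "real_of_int a0 < x" unfolding x_def by (rule real_less_rsqrt)
  then show "a0 < sqrt D" by (simp add: x_def)
  define z where "z = a0 + x"
  have z: "z > 1" using xa a0 by (simp add: z_def)
  define v where "v = fib_seq (real_of_int N) 1 z"
  have v: "0 < v j" "v j < v (Suc j)" for j
    using fib_seq_pos_less[of "real_of_int N" 1 z j] z N by (auto simp: v_def)
  have vu: "v (Suc j) = u (Suc j) * z + u j" for j
    unfolding v_def u_def of_int_fib_seq by (subst fib_seq_Suc) simp
  \<comment> \<open>Since \<open>(x - a0) * z = t\<close>, expanding both sides by \<open>vu\<close>
    reduces this to \<open>t'\<close>.\<close>
  have "(x - a0) * v k = v (Suc l)"
  proof -
    have "real_of_int (u k * t) = real_of_int (2 * u (Suc l) * a0 + u l)" by (simp only: t')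
    moreover have "x * x = a0 * a0 + t" using x2 D by (simp add: power2_eq_square)
    ultimately show ?thesis
      unfolding l vu z_def by (simp add: algebra_simps) algebra
  qed
  then have xv: "x - a0 = v (Suc l) / v k" using v(1)[of k] by (simp add: field_simps)
  have xlt: "x < a0 + 1"
  proof -
    have "v (Suc l) / v k < 1" using v(1)[of k] v(2)[of "Suc l"] by (simp add: l)
    then show ?thesis using xv by linarith
  qed
  have flx: "\<lfloor>x\<rfloor> = a0" using xa xlt by (intro floor_unique) auto
  show "cf_quot (sqrt D) 0 = a0" using flx by (simp add: cf_quot_def x_def)
  have flz: "\<lfloor>z\<rfloor> = 2 * a0" using xa xlt unfolding z_def by (intro floor_unique) auto
  have inner: thesis
    if "i mod k \<noteq> k - 1" and "\<And>j. k - i mod k = Suc (Suc j) \<Longrightarrow> thesis" for i thesis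
  proof -
    have "i mod k < k" using l by simp
    then have "k - i mod k = Suc (Suc (k - 2 - i mod k))" using that(1) by linarith
    then show thesis by (rule that(2))
  qed
  have cc: "cf_complete x (Suc i) = v (k - i mod k) / v (k - 1 - i mod k)" for i
  proof (induction i)
    case 0
    show ?case using xv flx by (simp add: l)
  next
    case (Suc i)
    show ?case
    proof (cases "i mod k = k - 1")
      \<comment> \<open>The last ratio is \<open>v 1 / v 0 = z\<close>, and
        \<open>z - 2 * a0 = x - a0\<close> starts the cycle again.\<close>
      case True
      then have "cf_complete x (Suc i) = z" using Suc l by (simp add: v_def)
      then have "cf_complete x (Suc (Suc i)) = 1 / (z - \<lfloor>z\<rfloor>)" by simp
      also have "\<dots> = v k / v (Suc l)" using xv flz by (simp add: z_def)
      finally show ?thesis using True l by (simp add: mod_Suc)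
    next
      case False
      then obtain j where j: "k - i mod k = Suc (Suc j)" by (rule inner)
      have "cf_complete x (Suc i) = v (Suc (Suc j)) / v (Suc j)"
        using Suc j by (metis diff_Suc_1 diff_commute)
      then have "cf_complete x (Suc (Suc i)) = 1 / (v j / v (Suc j))"
        using floor_fib_seq_ratio[OF N z, of j] by (simp add: v_def del: fib_seq.simps)
      moreover have "Suc i mod k = Suc (i mod k)" using False by (simp add: mod_Suc l)
      ultimately show ?thesis using j by (metis diff_Suc_1 diff_Suc_eq_diff_pred diff_commute divide_divide_eq_right mult_1)
    qed
  qed
  show "cf_quot (sqrt D) (Suc i) = (if i mod k = k - 1 then 2 * a0 else N)"
  proof (cases "i mod k = k - 1")
    case True
    then have "cf_complete x (Suc i) = z" using cc[of i] l by (simp add: v_def)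
    then show ?thesis using True flz by (simp add: cf_quot_def x_def)
  next
    case False
    then obtain j where j: "k - i mod k = Suc (Suc j)" by (rule inner)
    have "cf_complete x (Suc i) = v (Suc (Suc j)) / v (Suc j)"
      using cc[of i] j by (metis diff_Suc_1 diff_commute)
    then show ?thesis
      using False floor_fib_seq_ratio(2)[OF N z, of j]
      by (simp add: cf_quot_def v_def x_def del: fib_seq.simps cf_complete.simps)
  qed
qed

theorem theorem3p5:
  fixes m n k :: nat
  assumes "m > 0" and "n > 0" and "k > 0" and "odd n" and "even k"
  shows "\<exists>D::nat. D > 0 \<and> (\<nexists>r::nat. D = r ^ 2) \<and>
           (\<exists>(a0::int) (as::int list).
              cf_periodic_form (sqrt (real D)) a0 as \<and> length as = k \<and>
              a0 > 0 \<and> (\<forall>a\<in>set as. a > 0) \<and>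
              last as = 2 * a0 \<and> rev (butlast as) = butlast as) \<and>
           cf_period_length (sqrt (real D)) k \<and>
           [D = m] (mod n)"
proof -
  obtain l where l: "k = Suc (Suc l)" "even l"
    using \<open>k > 0\<close> \<open>even k\<close> by (metis even_Suc gr0_implies_Suc old.nat.exhaust odd_one One_nat_def)
  obtain h where h: "n = 2 * h + 1" using \<open>odd n\<close> by (elim oddE)
  define N where "N = 2 * int n"
  have N: "N \<ge> 1" using \<open>n > 0\<close> by (simp add: N_def)
  define A where "A = fib_seq N 0 1 k"
  define B where "B = fib_seq N 0 1 (Suc l)"
  define C where "C = fib_seq N 0 1 l"
  have "N dvd A" "[B = 1] (mod N)" "N dvd C"
    using fib_seq_parity[of k N] fib_seq_parity[of l N] \<open>even k\<close> l(2) by (auto simp: A_def B_def C_def)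
  then obtain A' B' C' where A': "A = N * A'" and B': "B - 1 = N * B'" and C': "C = N * C'"
    unfolding dvd_def cong_iff_dvd_diff by blast
  have cassini: "B\<^sup>2 = A * C + 1"
    using fib_seq_cassini[of N l] l by (simp add: A_def B_def C_def del: fib_seq.simps)
  have pos: "A \<ge> 1" "B \<ge> 1" "C \<ge> 0"
    using fib_seq_nonneg[OF N] l by (auto simp: A_def B_def C_def simp del: fib_seq.simps)
  \<comment> \<open>The factor 2 in \<open>N\<close> makes \<open>C\<close> even, so the half
    \<open>E\<close> is an integer and still divisible by \<open>n\<close>.\<close>
  define E where "E = int n * C'"
  have E: "C = 2 * E" by (simp add: C' N_def E_def)
  \<comment> \<open>As \<open>2 * (h + 1) = n + 1\<close>, the factor \<open>h + 1\<close> inverts 2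
    modulo \<open>n\<close>; the multiple of \<open>n\<close> makes \<open>s\<close> large enough
    for \<open>a0 > n\<close>.\<close>
  define s where "s = int m * (int h + 1) + int n * (B * E + int n + 1)"
  define a0 where "a0 = A * s - B * E"
  define t where "t = 2 * B * s - C\<^sup>2"
  define D where "D = a0\<^sup>2 + t"
  have "0 \<le> B * E" using pos E by simp
  then have "1 * (B * E + int n + 1) \<le> int n * (B * E + int n + 1)"
    using \<open>n > 0\<close> by (intro mult_right_mono) auto
  moreover have "0 \<le> int m * (int h + 1)" by simp
  ultimately have s: "s \<ge> B * E + int n + 1"
    unfolding s_def mult_1 by (rule add_increasing[rotated])
  have "1 * s \<le> A * s" using pos s \<open>0 \<le> B * E\<close> by (intro mult_right_mono) auto
  then have a0: "a0 > int n" using s by (simp add: a0_def)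
  \<comment> \<open>Both sides contain \<open>2 * A * B * s\<close>; the rest is
    \<open>A * C = B\<^sup>2 - 1\<close> multiplied by \<open>C\<close>.\<close>
  have "A * t = 2 * B * a0 + C"
    unfolding a0_def t_def E using cassini[unfolded E] by algebra
  then have At: "fib_seq N 0 1 k * t = 2 * fib_seq N 0 1 (k - 1) * a0 + fib_seq N 0 1 (k - 2)"
    by (simp add: A_def B_def C_def l)
  have k2: "k \<ge> 2" and a01: "a0 \<ge> 1" using l a0 by auto
  note cf = sqrt_cf_constant_inner[OF k2 N a01 D_def At]
  have Dpos: "D > 0" using cf(1) a01
    by (smt (verit) of_int_le_0_iff of_int_less_iff real_sqrt_le_0_iff of_int_0)
  define x where "x = sqrt (real (nat D))"
  have xD: "x = sqrt D" using Dpos by (simp add: x_def)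
  have q0: "cf_quot x 0 = a0" and xa: "a0 < x"
    and qS: "\<And>i. cf_quot x (Suc i) = (if i mod k = k - 1 then 2 * a0 else N)"
    using cf by (simp_all add: xD)
  define as where "as = replicate (k - 1) N @ [2 * a0]"
  have "nat D \<noteq> r\<^sup>2" for r
  proof
    assume "nat D = r\<^sup>2"
    then have "x = real r" by (simp add: x_def)
    then show False using q0 xa by (simp add: cf_quot_def)
  qed
  moreover have "cf_periodic_form x a0 as"
    unfolding cf_periodic_form_def
  proof (intro conjI allI)
    fix i
    have "i mod k < k" using \<open>k > 0\<close> by simp
    then consider "i mod k = k - 1" | "i mod k < k - 1" by linarith
    then show "cf_quot x (Suc i) = as ! (i mod length as)"
      using \<open>k > 0\<close> by cases (auto simp: qS as_def nth_append)
  qed (auto simp: as_def q0)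
  moreover have "length as = k" "a0 > 0" "\<forall>a\<in>set as. a > 0" "last as = 2 * a0"
    "rev (butlast as) = butlast as"
    using \<open>k > 0\<close> a01 N by (auto simp: as_def)
  moreover have "cf_period_length x k"
    unfolding cf_period_length_def
  proof (intro conjI allI impI)
    show "cf_period x k"
      unfolding cf_period_def
    proof (intro conjI allI impI)
      fix i :: nat assume "i \<ge> 1"
      then obtain i' where "i = Suc i'" by (cases i) auto
      then show "cf_quot x (i + k) = cf_quot x i" using qS by simp
    qed (fact \<open>k > 0\<close>)
    fix j assume j: "cf_period x j"
    show "k \<le> j"
    proof (rule ccontr)
      assume "\<not> k \<le> j"
      then obtain j' where j': "j = Suc j'" "j' < k - 1"
        using j by (cases j) (auto simp: cf_period_def)
      \<comment> \<open>A shorter period \<open>j\<close> would carry the quotient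
        \<open>2 * a0\<close> at index \<open>k\<close> to index \<open>k + j\<close>, where the
        quotient is \<open>N = 2 * n < 2 * a0\<close>.\<close>
      have "cf_quot x (Suc (j' + k)) = cf_quot x (Suc (k - 1))"
        using j j' \<open>k > 0\<close> unfolding cf_period_def
        by (metis One_nat_def Suc_leI Suc_pred add.commute add_Suc)
      then show False using j' a0 unfolding qS by (auto simp: N_def)
    qed
  qed
  moreover have "[nat D = m] (mod n)"
  proof -
    \<comment> \<open>Splitting \<open>2 * B * s\<close> as \<open>2 * (B - 1) * s + 2 * s\<close>
      isolates \<open>2 * s - m\<close>, which is the explicit multiple of \<open>n\<close> at the
      end.\<close>
    have "D - int m = (A * s - B * E)\<^sup>2 + 2 * ((B - 1) * s) - C\<^sup>2
        + int n * (int m + 2 * (B * E + int n + 1))"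
      by (simp add: D_def a0_def t_def s_def h algebra_simps)
    moreover have "int n dvd A" "int n dvd B - 1" "int n dvd C" "int n dvd E"
      unfolding A' B' C' E_def N_def by auto
    ultimately have "int n dvd D - int m" by (simp add: power2_eq_square)
    then have "[D = int m] (mod int n)" by (simp add: cong_iff_dvd_diff)
    then have "[int (nat D) = int m] (mod int n)" using Dpos by simp
    then show ?thesis by (simp only: cong_int_iff)
  qed
  ultimately show ?thesis
    using Dpos unfolding x_def by (intro exI[of _ "nat D"] conjI exI[of _ a0] exI[of _ as]) auto
qed

end
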